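(* Let $L>0$ and let $\mathcal{D}$ be a distribution on $[0,L]$. For $m,n\in\mathbb{Z}$ put $$q_{m,n}:=\langle U_m\mid U_n\rangle_Q:=\mathcal{D}\big(y\mapsto (U_m^**U_n)(y)+(U_m^**U_n)(-y)\big),\qquad y\in[0,L],$$ and let $$\psi(x):=\frac1\pi\,\mathcal{D}\big(y\mapsto \sin(2\pi x(1-y/L))\big)=\frac 1\pi\int_0^L\sin(2\pi x(1-y/L))\,\mathcal{D}(y)\,dy,\qquad x\in\mathbb{R}.$$ Then $$q_{m,n}=\begin{cases}\dfrac{\psi(m)-\psi(n)}{m-n} & \text{if } n\neq m,\\[1ex] \psi'(n) & \text{if } n=m.\end{cases}$$
   Context: A distribution $\mathcal{D}$ on $[0,L]$ is a continuous linear form on $C^\infty([0,L])$ (functions smooth up to the boundary), written formally $\mathcal{D}(f)=\int_0^L f(y)\mathcal{D}(y)dy$. The functions $U_n(x)=L^{-1/2}\exp(2\pi i n x/L)$ for $x\in[0,L]$, $n\in\mathbb{Z}$, are extended to $\mathbb{R}$ by $0$ outside $[0,L]$. For functions on $\mathbb{R}$, $f^*(x):=\overline{f(-x)}$ and $(f*g)(y):=\int f(x)g(y-x)\,dx$. The function $y\mapsto (U_m^**U_n)(y)+(U_m^**U_n)(-y)$ restricted to $[0,L]$ is smooth. *)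

theory Defs
  imports "HOL-Analysis.Analysis"
begin

text \<open>Derivatives on \<open>[0,L]\<close> are taken within the interval, hence one-sided at the endpoints.\<close>

definition nderiv_Icc :: "real \<Rightarrow> nat \<Rightarrow> (real \<Rightarrow> complex) \<Rightarrow> real \<Rightarrow> complex" where
  "nderiv_Icc L k = (\<lambda>f x. vector_derivative f (at x within {0..L})) ^^ k"

text \<open>Elements of \<open>C\<^sup>\<infinity>([0,L])\<close> are represented by total functions on the reals, whose values
  outside \<open>[0,L]\<close> are irrelevant to both this set and the topology below.\<close>

definition smooth_Icc :: "real \<Rightarrow> (real \<Rightarrow> complex) set" where
  "smooth_Icc L = {f. \<forall>k. nderiv_Icc L k f differentiable_on {0..L}}"

text \<open>The Frechet topology of uniform convergence of every derivative on \<open>[0,L]\<close>, generated by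
  the balls of the seminorms \<open>f \<mapsto> sup \<bar>f\<^sup>(\<^sup>k\<^sup>)\<bar>\<close>; its underlying set is \<open>smooth_Icc L\<close>.
  Representatives that agree on \<open>[0,L]\<close> are topologically indistinguishable, so a continuous map
  into a Hausdorff space takes the same value on them.\<close>

definition smooth_Icc_topology :: "real \<Rightarrow> (real \<Rightarrow> complex) topology" where
  "smooth_Icc_topology L = topology_generated_by
     {{g \<in> smooth_Icc L. (SUP x\<in>{0..L}. norm (nderiv_Icc L k g x - nderiv_Icc L k f x)) < e}
      | f k e. f \<in> smooth_Icc L \<and> e > 0}"

definition distribution_Icc :: "real \<Rightarrow> ((real \<Rightarrow> complex) \<Rightarrow> complex) \<Rightarrow> bool" where
  "distribution_Icc L \<D> \<longleftrightarrow>
     (\<forall>f\<in>smooth_Icc L. \<forall>g\<in>smooth_Icc L. \<D> (\<lambda>y. f y + g y) = \<D> f + \<D> g) \<and>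
     (\<forall>c. \<forall>f\<in>smooth_Icc L. \<D> (\<lambda>y. c * f y) = c * \<D> f) \<and>
     continuous_map (smooth_Icc_topology L) euclidean \<D>"

definition U :: "real \<Rightarrow> int \<Rightarrow> real \<Rightarrow> complex" where
  "U L n x = (if x \<in> {0..L}
     then of_real (L powr (-1/2)) * exp (2 * of_real pi * \<i> * of_int n * of_real x / of_real L)
     else 0)"

definition star :: "(real \<Rightarrow> complex) \<Rightarrow> real \<Rightarrow> complex" where
  "star f x = cnj (f (- x))"

definition convolution :: "(real \<Rightarrow> complex) \<Rightarrow> (real \<Rightarrow> complex) \<Rightarrow> real \<Rightarrow> complex" where
  "convolution f g y = (LINT x|lborel. f x * g (y - x))"

definition Q_form ::
    "((real \<Rightarrow> complex) \<Rightarrow> complex) \<Rightarrow> (real \<Rightarrow> complex) \<Rightarrow> (real \<Rightarrow> complex) \<Rightarrow> complex" where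
  "Q_form \<D> f g = \<D> (\<lambda>y. convolution (star f) g y + convolution (star f) g (- y))"

definition psi :: "real \<Rightarrow> ((real \<Rightarrow> complex) \<Rightarrow> complex) \<Rightarrow> real \<Rightarrow> complex" where
  "psi L \<D> x = 1 / of_real pi * \<D> (\<lambda>y. of_real (sin (2 * pi * x * (1 - y / L))))"

end

(* The convolutions are elementary integrals: on [0,L] the symmetrised function
   (U_m^* * U_n)(y) + (U_m^* * U_n)(-y) equals (k_m(y) - k_n(y)) / (pi (m - n)) for m <> n, with
   k_x(y) = sin (2 pi x (1 - y/L)), and it equals 1/pi times the x-derivative of k_x(y) at x = n
   for m = n. The first case follows by linearity of D. For the second, the difference quotients
   of k_x in x converge together with all their y-derivatives, uniformly in y, so that
   continuity of D allows differentiation under D. *)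

theory Submission
  imports Defs
begin

section \<open>Smooth functions on the closed interval and their iterated derivatives\<close>

text \<open>Computes all iterated derivatives from a chain \<open>G\<close> guessed in advance.
  Induction on \<open>k\<close> works because, for \<open>L > 0\<close>, a derivative within
  \<open>{0..L}\<close> is unique at every point, endpoints included, and depends only on values in
  \<open>{0..L}\<close>.\<close>

lemma smooth_Icc_I:
  fixes G :: "nat \<Rightarrow> real \<Rightarrow> complex"
  assumes "L > 0"
    and G: "\<And>k y. y \<in> {0..L} \<Longrightarrow> (G k has_vector_derivative G (Suc k) y) (at y within {0..L})"
    and f: "\<And>y. y \<in> {0..L} \<Longrightarrow> f y = G 0 y"
  shows nderiv_Icc_eqI: "\<And>y. y \<in> {0..L} \<Longrightarrow> nderiv_Icc L k f y = G k y"
    and "f \<in> smooth_Icc L"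
proof -
  have eq: "\<forall>y\<in>{0..L}. nderiv_Icc L k f y = G k y" for k
  proof (induction k)
    case 0
    then show ?case by (simp add: nderiv_Icc_def f)
  next
    case (Suc k)
    show ?case
    proof
      fix y assume y: "y \<in> {0..L}"
      have "(nderiv_Icc L k f has_vector_derivative G (Suc k) y) (at y within {0..L})"
        using Suc by (intro has_vector_derivative_transform[OF y _ G[OF y]]) auto
      then have "vector_derivative (nderiv_Icc L k f) (at y within {0..L}) = G (Suc k) y"
        using vector_derivative_within_closed_interval[OF \<open>L > 0\<close> y] by blast
      then show "nderiv_Icc L (Suc k) f y = G (Suc k) y"
        by (simp add: nderiv_Icc_def)
    qed
  qed
  then show "\<And>y. y \<in> {0..L} \<Longrightarrow> nderiv_Icc L k f y = G k y" by blast
  have "nderiv_Icc L k f differentiable (at y within {0..L})" if y: "y \<in> {0..L}" for k y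
    using has_vector_derivative_transform[OF y _ G[OF y], of "nderiv_Icc L k f"] eq
    by (metis differentiableI_vector)
  then show "f \<in> smooth_Icc L"
    by (simp add: smooth_Icc_def differentiable_on_def)
qed

lemma has_vector_derivative_nderiv_Icc:
  assumes "f \<in> smooth_Icc L" "y \<in> {0..L}"
  shows "(nderiv_Icc L k f has_vector_derivative nderiv_Icc L (Suc k) f y) (at y within {0..L})"
  using assms by (auto simp: smooth_Icc_def differentiable_on_def vector_derivative_works nderiv_Icc_def)

lemma nderiv_Icc_0 [simp]: "nderiv_Icc L 0 f = f"
  by (simp add: nderiv_Icc_def)

text \<open>The chain of derivatives of \<open>f\<close> itself serves as the chain for
  \<open>g\<close>.\<close>

lemma smooth_Icc_cong:
  assumes "L > 0" "f \<in> smooth_Icc L" "\<And>y. y \<in> {0..L} \<Longrightarrow> g y = f y"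
  shows "g \<in> smooth_Icc L"
    and nderiv_Icc_cong: "y \<in> {0..L} \<Longrightarrow> nderiv_Icc L k g y = nderiv_Icc L k f y"
  using smooth_Icc_I[of L "\<lambda>k. nderiv_Icc L k f" g] assms has_vector_derivative_nderiv_Icc
  by auto

lemma smooth_Icc_cmult:
  assumes "L > 0" "f \<in> smooth_Icc L"
  shows "(\<lambda>y. c * f y) \<in> smooth_Icc L"
  using assms has_vector_derivative_nderiv_Icc
  by (intro smooth_Icc_I(2)[of L "\<lambda>k y. c * nderiv_Icc L k f y"]) (auto intro!: derivative_eq_intros)

lemma smooth_Icc_diff:
  assumes "L > 0" "f \<in> smooth_Icc L" "g \<in> smooth_Icc L"
  shows "(\<lambda>y. f y - g y) \<in> smooth_Icc L"
  using assms has_vector_derivative_nderiv_Icc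
  by (intro smooth_Icc_I(2)[of L "\<lambda>k y. nderiv_Icc L k f y - nderiv_Icc L k g y"])
    (auto intro!: derivative_intros)

section \<open>Convergence in the Frechet topology\<close>

lemma topspace_smooth_Icc_topology: "L \<ge> 0 \<Longrightarrow> topspace (smooth_Icc_topology L) = smooth_Icc L"
proof (rule antisym)
  assume "L \<ge> 0"
  show "smooth_Icc L \<subseteq> topspace (smooth_Icc_topology L)"
  proof
    fix f assume f: "f \<in> smooth_Icc L"
    \<comment> \<open>The unit ball around \<open>f\<close> for the seminorm of order 0. Since
      \<open>{0..L}\<close> is nonempty, the supremum of the zero function over it is 0.\<close>
    have "f \<in> {g \<in> smooth_Icc L. (SUP x\<in>{0..L}. norm (nderiv_Icc L 0 g x - nderiv_Icc L 0 f x)) < 1}"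
      using f \<open>L \<ge> 0\<close> by simp
    then show "f \<in> topspace (smooth_Icc_topology L)"
      unfolding smooth_Icc_topology_def topology_generated_by_topspace
      using f zero_less_one by blast
  qed
qed (auto simp: smooth_Icc_topology_def)

text \<open>The sets \<open>V\<close> for which \<open>g\<close> in \<open>V\<close> forces
  \<open>q h\<close> in \<open>V\<close> eventually are closed under finite intersections and
  arbitrary unions, so only the generating balls matter. Such a ball may be centred at some
  \<open>f\<close> other than \<open>g\<close>; the triangle inequality handles this.\<close>

lemma limitin_smooth_Icc_topology:
  assumes "L > 0" and g: "g \<in> smooth_Icc L"
    and q: "\<forall>\<^sub>F h in F. q h \<in> smooth_Icc L"
    and lim: "\<And>k e. e > 0 \<Longrightarrow>
      \<forall>\<^sub>F h in F. \<forall>y\<in>{0..L}. norm (nderiv_Icc L k (q h) y - nderiv_Icc L k g y) \<le> e"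
  shows "limitin (smooth_Icc_topology L) q g F"
proof -
  let ?B = "{{g \<in> smooth_Icc L. (SUP x\<in>{0..L}. norm (nderiv_Icc L k g x - nderiv_Icc L k f x)) < e}
      | f k e. f \<in> smooth_Icc L \<and> e > 0}"
  have "g \<in> V \<longrightarrow> (\<forall>\<^sub>F h in F. q h \<in> V)" if "generate_topology_on ?B V" for V
    using that
  proof induction
    case (Int a b)
    then show ?case by (auto elim: eventually_elim2)
  next
    case (UN K)
    show ?case
    proof
      assume "g \<in> \<Union>K"
      then obtain V where V: "V \<in> K" "g \<in> V" by blast
      then have "\<forall>\<^sub>F h in F. q h \<in> V" using UN.IH by blast
      then show "\<forall>\<^sub>F h in F. q h \<in> \<Union>K" by eventually_elim (use V in blast)
    qed
  next
    case (Basis V)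
    then obtain f k e where f: "f \<in> smooth_Icc L" and V: "V = {g \<in> smooth_Icc L.
        (SUP x\<in>{0..L}. norm (nderiv_Icc L k g x - nderiv_Icc L k f x)) < e}"
      by blast
    define s where "s = (SUP x\<in>{0..L}. norm (nderiv_Icc L k g x - nderiv_Icc L k f x))"
    have cont: "continuous_on {0..L} (nderiv_Icc L k f)" if "f \<in> smooth_Icc L" for f
      using that by (auto simp: smooth_Icc_def differentiable_imp_continuous_on)
    \<comment> \<open>Boundedness, here from compactness of \<open>{0..L}\<close>, is what makes the
      real supremum an upper bound of the values.\<close>
    have bdd: "bdd_above ((\<lambda>x. norm (nderiv_Icc L k g x - nderiv_Icc L k f x)) ` {0..L})"
      using cont[OF f] cont[OF g]
      by (intro bounded_imp_bdd_above compact_imp_bounded compact_continuous_image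
          continuous_intros compact_Icc)
    show ?case
    proof
      assume "g \<in> V"
      then have se: "s < e" by (simp add: V s_def)
      \<comment> \<open>Half of the slack \<open>e - s\<close> is spent, so the new supremum is at
        most \<open>(e + s) / 2\<close>, still strictly below \<open>e\<close>.\<close>
      have "\<forall>\<^sub>F h in F. \<forall>y\<in>{0..L}. norm (nderiv_Icc L k (q h) y - nderiv_Icc L k g y) \<le> (e - s) / 2"
        using se by (intro lim) simp
      with q show "\<forall>\<^sub>F h in F. q h \<in> V"
      proof eventually_elim
        case (elim h)
        have "(SUP x\<in>{0..L}. norm (nderiv_Icc L k (q h) x - nderiv_Icc L k f x)) \<le> (e - s) / 2 + s"
        proof (rule cSUP_least)
          fix x assume x: "x \<in> {0..L}"
          have "norm (nderiv_Icc L k g x - nderiv_Icc L k f x) \<le> s"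
            unfolding s_def by (rule cSUP_upper[OF x bdd])
          then show "norm (nderiv_Icc L k (q h) x - nderiv_Icc L k f x) \<le> (e - s) / 2 + s"
            using elim(2) x by (intro norm_diff_triangle_le[of _ "nderiv_Icc L k g x"]) auto
        qed (use \<open>L > 0\<close> in auto)
        with elim(1) se show ?case by (simp add: V field_simps)
      qed
    qed
  qed auto
  then show ?thesis
    using g \<open>L > 0\<close> topspace_smooth_Icc_topology[of L]
    by (auto simp: limitin_def smooth_Icc_topology_def openin_topology_generated_by_iff)
qed

section \<open>Distributions and differentiation under the distribution\<close>

context
  fixes L :: real and \<D> :: "(real \<Rightarrow> complex) \<Rightarrow> complex"
  assumes L: "L > 0" and D: "distribution_Icc L \<D>"
begin

lemma distribution_Icc_tendsto:
  assumes "limitin (smooth_Icc_topology L) q g F"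
  shows "((\<lambda>h. \<D> (q h)) \<longlongrightarrow> \<D> g) F"
  using continuous_map_limit[OF _ assms, of euclidean \<D>] D
  by (simp add: distribution_Icc_def o_def)

text \<open>Two functions that agree on \<open>[0,L]\<close> cannot be separated by the topology: the constant
  sequence \<open>f\<close> converges to \<open>g\<close>.\<close>

lemma distribution_Icc_cong:
  assumes "f \<in> smooth_Icc L" "\<And>y. y \<in> {0..L} \<Longrightarrow> g y = f y"
  shows "\<D> g = \<D> f"
proof -
  have "limitin (smooth_Icc_topology L) (\<lambda>_::nat. f) g sequentially"
  proof (rule limitin_smooth_Icc_topology[OF L])
    show "g \<in> smooth_Icc L"
      by (rule smooth_Icc_cong[OF L assms])
    show "\<forall>\<^sub>F h in sequentially. \<forall>y\<in>{0..L}. norm (nderiv_Icc L k f y - nderiv_Icc L k g y) \<le> e"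
      if "e > 0" for k e
      using that by (simp only: nderiv_Icc_cong[OF L assms] cong: ball_cong) simp
  qed (simp add: assms(1))
  from distribution_Icc_tendsto[OF this] show ?thesis
    by (simp add: LIMSEQ_const_iff)
qed

lemma distribution_Icc_cmult: "f \<in> smooth_Icc L \<Longrightarrow> \<D> (\<lambda>y. c * f y) = c * \<D> f"
  using D by (auto simp: distribution_Icc_def)

lemma distribution_Icc_diff:
  assumes "f \<in> smooth_Icc L" "g \<in> smooth_Icc L"
  shows "\<D> (\<lambda>y. f y - g y) = \<D> f - \<D> g"
proof -
  have "\<D> (\<lambda>y. f y + (-1) * g y) = \<D> f + \<D> (\<lambda>y. (-1) * g y)"
    using D assms smooth_Icc_cmult[OF L, of g "-1"] by (auto simp: distribution_Icc_def)
  then show ?thesis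
    using distribution_Icc_cmult[OF assms(2), of "-1"] by simp
qed

text \<open>Differentiation under \<open>\<D>\<close>. Here \<open>G k\<close> is the
  \<open>k\<close>-th \<open>y\<close>-derivative of \<open>G 0\<close>, and \<open>H k\<close> is
  both the \<open>x\<close>-derivative of \<open>G k\<close> and the \<open>k\<close>-th
  \<open>y\<close>-derivative of \<open>H 0\<close>, so the interchange of partial derivatives is
  built into the assumptions. The difference quotients then converge in every seminorm, and
  continuity of \<open>\<D>\<close> carries the limit over.\<close>

lemma distribution_Icc_has_vector_derivative:
  fixes G H :: "nat \<Rightarrow> real \<Rightarrow> real \<Rightarrow> complex"
  assumes Gy: "\<And>k x y. y \<in> {0..L} \<Longrightarrow> (G k x has_vector_derivative G (Suc k) x y) (at y within {0..L})"
    and Hy: "\<And>k x y. y \<in> {0..L} \<Longrightarrow> (H k x has_vector_derivative H (Suc k) x y) (at y within {0..L})"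
    and Gx: "\<And>k x y. y \<in> {0..L} \<Longrightarrow> ((\<lambda>x. G k x y) has_vector_derivative H k x y) (at x)"
    and cont: "\<And>k. continuous_on (UNIV \<times> {0..L}) (\<lambda>(x, y). H k x y)"
  shows "((\<lambda>x. \<D> (G 0 x)) has_vector_derivative \<D> (H 0 x0)) (at x0)"
proof -
  have Gs: "G 0 x \<in> smooth_Icc L" for x
    using Gy by (intro smooth_Icc_I(2)[OF L, of "\<lambda>k. G k x"]) auto
  have Hs: "H 0 x0 \<in> smooth_Icc L"
    using Hy by (intro smooth_Icc_I(2)[OF L, of "\<lambda>k. H k x0"]) auto
  \<comment> \<open>The difference quotient in \<open>x\<close>. At \<open>x = x0\<close> the
    convention \<open>inverse 0 = 0\<close> makes it the zero function, so it is smooth for every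
    \<open>x\<close>.\<close>
  define q where "q x = (\<lambda>y. inverse (of_real (x - x0)) * (G 0 x y - G 0 x0 y))" for x
  have q': "((\<lambda>y. inverse (of_real (x - x0)) * (G k x y - G k x0 y)) has_vector_derivative
      inverse (of_real (x - x0)) * (G (Suc k) x y - G (Suc k) x0 y)) (at y within {0..L})"
    if "y \<in> {0..L}" for k x y
    using Gy[OF that] by (intro has_vector_derivative_mult_right has_vector_derivative_diff)
  have qs: "q x \<in> smooth_Icc L" for x
    using smooth_Icc_cmult smooth_Icc_diff Gs L by (simp add: q_def)
  have qk: "nderiv_Icc L k (q x) y = inverse (of_real (x - x0)) * (G k x y - G k x0 y)"
    if "y \<in> {0..L}" for k x y
    by (rule nderiv_Icc_eqI[where G = "\<lambda>k y. inverse (of_real (x - x0)) * (G k x y - G k x0 y)",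
          OF L q' _ that]) (simp_all add: q_def)
  have Hk: "nderiv_Icc L k (H 0 x0) y = H k x0 y" if "y \<in> {0..L}" for k y
    using nderiv_Icc_eqI[OF L, of "\<lambda>k. H k x0"] Hy that by blast
  have "limitin (smooth_Icc_topology L) q (H 0 x0) (at x0)"
  proof (rule limitin_smooth_Icc_topology[OF L Hs])
    fix k and e :: real assume "e > 0"
    \<comment> \<open>On this compact set \<open>H k\<close> is uniformly continuous, which gives a
      \<open>d\<close> that does not depend on \<open>y\<close>.\<close>
    let ?K = "cball x0 1 \<times> {0..L}"
    have "uniformly_continuous_on ?K (\<lambda>(x, y). H k x y)"
      by (intro compact_uniformly_continuous continuous_on_subset[OF cont] compact_Times) auto
    then obtain d where "d > 0" and d: "\<And>p p'. p \<in> ?K \<Longrightarrow> p' \<in> ?K \<Longrightarrow> dist p' p < d \<Longrightarrow>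
        dist ((\<lambda>(x, y). H k x y) p') ((\<lambda>(x, y). H k x y) p) < e"
      unfolding uniformly_continuous_on_def using \<open>e > 0\<close> by metis
    \<comment> \<open>The bound 1 keeps \<open>cball x0 r\<close> inside the first factor of
      \<open>?K\<close>; halving \<open>d\<close> keeps even its boundary points at distance less
      than \<open>d\<close> from \<open>x0\<close>.\<close>
    define r where "r = min 1 (d / 2)"
    have r: "r > 0" "r \<le> 1" "r < d" using \<open>d > 0\<close> by (auto simp: r_def)
    have "\<forall>\<^sub>F x in at x0. x \<noteq> x0 \<and> dist x x0 < r"
      using r(1) by (auto simp: eventually_at)
    then show "\<forall>\<^sub>F x in at x0. \<forall>y\<in>{0..L}.
        norm (nderiv_Icc L k (q x) y - nderiv_Icc L k (H 0 x0) y) \<le> e"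
    proof eventually_elim
      case (elim x)
      show ?case
      proof
        fix y assume y: "y \<in> {0..L}"
        \<comment> \<open>Mean value inequality in \<open>x\<close> for fixed \<open>y\<close>:
          along the segment from \<open>x0\<close> to \<open>x\<close> the derivative stays within
          \<open>e\<close> of \<open>H k x0 y\<close>.\<close>
        have "norm (G k x y - G k x0 y - (x - x0) *\<^sub>R H k x0 y) \<le> norm (x - x0) * e"
        proof (rule vector_differentiable_bound_linearization[where S = "cball x0 r" and f' = "\<lambda>x. H k x y"])
          show "norm (H k t y - H k x0 y) \<le> e" if "t \<in> cball x0 r" for t
            using d[of "(x0, y)" "(t, y)"] that y r
            by (simp add: dist_norm norm_Pair) argo
          show "closed_segment x0 x \<subseteq> cball x0 r"
            using elim r by (intro closed_segment_subset) (auto simp: dist_commute)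
        qed (use Gx[OF y] r in \<open>auto intro: has_vector_derivative_at_within\<close>)
        moreover have *: "nderiv_Icc L k (q x) y - nderiv_Icc L k (H 0 x0) y =
            inverse (of_real (x - x0)) * (G k x y - G k x0 y - (x - x0) *\<^sub>R H k x0 y)"
          using elim by (simp add: qk[OF y] Hk[OF y] scaleR_conv_of_real field_simps)
        ultimately show "norm (nderiv_Icc L k (q x) y - nderiv_Icc L k (H 0 x0) y) \<le> e"
          using elim unfolding * norm_mult norm_inverse norm_of_real
          by (simp add: inverse_eq_divide pos_divide_le_eq mult.commute)
      qed
    qed
  qed (simp add: qs)
  then have lim: "((\<lambda>x. \<D> (q x)) \<longlongrightarrow> \<D> (H 0 x0)) (at x0)"
    by (rule distribution_Icc_tendsto)
  have Dq: "\<D> (q x) = inverse (of_real (x - x0)) * (\<D> (G 0 x) - \<D> (G 0 x0))" for x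
    using distribution_Icc_cmult[OF smooth_Icc_diff[OF L Gs Gs]] distribution_Icc_diff[OF Gs Gs]
    by (simp add: q_def)
  have "((\<lambda>x. norm (\<D> (q x) - \<D> (H 0 x0))) \<longlongrightarrow> 0) (at x0)"
    using lim by (intro tendsto_norm_zero) (simp add: LIM_zero)
  \<comment> \<open>This is the remainder quotient in the definition of the derivative. The identity
    is needed only for \<open>x\<close> different from \<open>x0\<close>, as the filter
    \<open>at x0\<close> ignores that point.\<close>
  moreover have "\<forall>\<^sub>F x in at x0. norm (\<D> (q x) - \<D> (H 0 x0)) =
      norm (\<D> (G 0 x) - \<D> (G 0 x0) - (x - x0) *\<^sub>R \<D> (H 0 x0)) / norm (x - x0)"
    unfolding eventually_at_filter
  proof (intro always_eventually allI impI)
    fix x assume "x \<noteq> x0"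
    then have *: "\<D> (q x) - \<D> (H 0 x0) =
        inverse (of_real (x - x0)) * (\<D> (G 0 x) - \<D> (G 0 x0) - (x - x0) *\<^sub>R \<D> (H 0 x0))"
      by (simp add: Dq scaleR_conv_of_real field_simps)
    then show "norm (\<D> (q x) - \<D> (H 0 x0)) =
        norm (\<D> (G 0 x) - \<D> (G 0 x0) - (x - x0) *\<^sub>R \<D> (H 0 x0)) / norm (x - x0)"
      unfolding * norm_mult norm_inverse norm_of_real by (simp add: divide_inverse mult.commute)
  qed
  ultimately show ?thesis
    by (simp add: has_vector_derivative_def has_derivative_iff_norm bounded_linear_scaleR_left
        tendsto_cong)
qed

end

section \<open>The sine kernel, its derivatives, and the derivative of \<open>psi\<close>\<close>

text \<open>The \<open>k\<close>-th \<open>y\<close>-derivative of \<open>sin (2\<pi>x(1 - y/L))\<close>: each derivative contributes a factor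
  \<open>-2\<pi>x/L\<close> and a phase shift by \<open>\<pi>/2\<close>. Its \<open>x\<close>-derivative is \<open>psi_kernel_deriv\<close>.\<close>

definition psi_kernel :: "real \<Rightarrow> nat \<Rightarrow> real \<Rightarrow> real \<Rightarrow> complex" where
  "psi_kernel L k x y = of_real ((- 2 * pi / L * x) ^ k * sin (x * (2 * pi * (1 - y / L)) + k * (pi / 2)))"

definition psi_kernel_deriv :: "real \<Rightarrow> nat \<Rightarrow> real \<Rightarrow> real \<Rightarrow> complex" where
  "psi_kernel_deriv L k x y = of_real
     (k * (- 2 * pi / L) * (- 2 * pi / L * x) ^ (k - 1) * sin (x * (2 * pi * (1 - y / L)) + k * (pi / 2)) +
      (- 2 * pi / L * x) ^ k * (2 * pi * (1 - y / L)) * cos (x * (2 * pi * (1 - y / L)) + k * (pi / 2)))"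

lemma sin_cos_add_Suc_quarter:
  "sin (a + real (Suc k) * (pi / 2)) = cos (a + k * (pi / 2))"
  "cos (a + real (Suc k) * (pi / 2)) = - sin (a + k * (pi / 2))"
proof -
  have "a + real (Suc k) * (pi / 2) = (a + k * (pi / 2)) + pi / 2"
    by (simp add: algebra_simps)
  then show "sin (a + real (Suc k) * (pi / 2)) = cos (a + k * (pi / 2))"
    "cos (a + real (Suc k) * (pi / 2)) = - sin (a + k * (pi / 2))"
    by (simp_all only: sin_add cos_add sin_pi_half cos_pi_half) simp_all
qed

lemma psi_kernel_has_vector_derivative_y:
  assumes "L > 0"
  shows "(psi_kernel L k x has_vector_derivative psi_kernel L (Suc k) x y) (at y within S)"
proof -
  define c where "c = - 2 * pi / L"
  define t where "t y = 2 * pi * (1 - y / L)" for y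
  have t: "(t has_real_derivative c) (at y within S)"
    unfolding t_def c_def using assms by (auto intro!: derivative_eq_intros)
  have "((\<lambda>y. (c * x) ^ k * sin (x * t y + k * (pi / 2))) has_real_derivative
      (c * x) ^ k * (cos (x * t y + k * (pi / 2)) * (x * c))) (at y within S)"
    by (rule derivative_eq_intros t refl | simp)+
  then show ?thesis
    unfolding psi_kernel_def sin_cos_add_Suc_quarter c_def[symmetric] t_def[symmetric]
    by (intro has_vector_derivative_of_real)
      (simp add: has_real_derivative_iff_has_vector_derivative mult_ac)
qed

lemma psi_kernel_has_vector_derivative_x:
  "((\<lambda>x. psi_kernel L k x y) has_vector_derivative psi_kernel_deriv L k x y) (at x)"
proof -
  define c where "c = - 2 * pi / L"
  define t where "t = 2 * pi * (1 - y / L)"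
  have "((\<lambda>x. (c * x) ^ k * sin (x * t + k * (pi / 2))) has_real_derivative
      k * c * (c * x) ^ (k - 1) * sin (x * t + k * (pi / 2)) +
      (c * x) ^ k * t * cos (x * t + k * (pi / 2))) (at x)"
    by (rule derivative_eq_intros refl | simp)+
  then show ?thesis
    unfolding psi_kernel_def psi_kernel_deriv_def c_def[symmetric] t_def[symmetric]
    by (intro has_vector_derivative_of_real)
      (simp add: has_real_derivative_iff_has_vector_derivative)
qed

lemma psi_kernel_deriv_has_vector_derivative_y:
  assumes "L > 0"
  shows "(psi_kernel_deriv L k x has_vector_derivative psi_kernel_deriv L (Suc k) x y) (at y within S)"
proof -
  define c where "c = - 2 * pi / L"
  define t where "t y = 2 * pi * (1 - y / L)" for y
  have t: "(t has_real_derivative c) (at y within S)"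
    unfolding t_def c_def using assms by (auto intro!: derivative_eq_intros)
  \<comment> \<open>The truncated \<open>k - 1\<close> is harmless: for \<open>k = 0\<close> the
    factor \<open>k\<close> makes both sides zero.\<close>
  have k: "real k * c * (c * x) ^ (k - 1) * (c * x) = k * c * (c * x) ^ k"
    by (cases k) auto
  let ?s = "\<lambda>y. sin (x * t y + k * (pi / 2))" and ?c = "\<lambda>y. cos (x * t y + k * (pi / 2))"
  have s': "(?s has_real_derivative ?c y * (x * c)) (at y within S)"
    and c': "(?c has_real_derivative - ?s y * (x * c)) (at y within S)"
    by (rule derivative_eq_intros t refl | simp)+
  have "((\<lambda>y. k * c * (c * x) ^ (k - 1) * ?s y + (c * x) ^ k * t y * ?c y) has_real_derivative
      k * c * (c * x) ^ (k - 1) * (?c y * (x * c)) +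
      ((c * x) ^ k * c * ?c y + (- ?s y * (x * c)) * ((c * x) ^ k * t y))) (at y within S)"
    by (intro DERIV_add DERIV_cmult DERIV_mult s' c' t)
  also have "k * c * (c * x) ^ (k - 1) * (?c y * (x * c)) = (k * c * (c * x) ^ (k - 1) * (c * x)) * ?c y"
    by (simp add: mult_ac)
  \<comment> \<open>The sine term contributes \<open>k\<close> copies of
    \<open>c * (c * x) ^ k * ?c y\<close>, and differentiating the factor \<open>t y\<close>
    contributes one more, which yields \<open>Suc k\<close>.\<close>
  also have "\<dots> + ((c * x) ^ k * c * ?c y + (- ?s y * (x * c)) * ((c * x) ^ k * t y)) =
      real (Suc k) * c * (c * x) ^ (Suc k - 1) * ?c y + (c * x) ^ Suc k * t y * (- ?s y)"
    unfolding k by (simp add: algebra_simps)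
  finally show ?thesis
    unfolding psi_kernel_deriv_def sin_cos_add_Suc_quarter c_def[symmetric] t_def[symmetric]
    by (intro has_vector_derivative_of_real)
      (simp only: has_real_derivative_iff_has_vector_derivative)
qed

lemma continuous_on_psi_kernel_deriv:
  assumes "L > 0"
  shows "continuous_on S (\<lambda>(x, y). psi_kernel_deriv L k x y)"
  unfolding psi_kernel_deriv_def case_prod_unfold using assms by (intro continuous_intros) auto

lemma psi_kernel_0: "psi_kernel L 0 x = (\<lambda>y. of_real (sin (2 * pi * x * (1 - y / L))))"
  by (simp add: psi_kernel_def fun_eq_iff ac_simps)

text \<open>At order 0 \<open>psi_kernel\<close> is the test function in the definition of
  \<open>psi\<close>, and the two explicit kernel families meet the assumptions for differentiating
  under \<open>\<D>\<close>.\<close>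

lemma psi_has_vector_derivative:
  assumes "L > 0" "distribution_Icc L \<D>"
  shows "(psi L \<D> has_vector_derivative 1 / of_real pi * \<D> (psi_kernel_deriv L 0 x)) (at x)"
proof -
  have "((\<lambda>x. \<D> (psi_kernel L 0 x)) has_vector_derivative \<D> (psi_kernel_deriv L 0 x)) (at x)"
    by (rule distribution_Icc_has_vector_derivative[where G = "psi_kernel L" and H = "psi_kernel_deriv L",
          OF assms psi_kernel_has_vector_derivative_y[OF assms(1)] psi_kernel_deriv_has_vector_derivative_y[OF assms(1)]
          psi_kernel_has_vector_derivative_x continuous_on_psi_kernel_deriv[OF assms(1)]])
  then have "((\<lambda>x. 1 / of_real pi * \<D> (psi_kernel L 0 x)) has_vector_derivative
      1 / of_real pi * \<D> (psi_kernel_deriv L 0 x)) (at x)"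
    by (rule has_vector_derivative_mult_right)
  moreover have "psi L \<D> = (\<lambda>x. 1 / of_real pi * \<D> (psi_kernel L 0 x))"
    by (simp add: fun_eq_iff psi_def psi_kernel_0)
  ultimately show ?thesis by simp
qed

section \<open>Evaluation of the symmetrised convolutions\<close>

text \<open>The integrand lives where both \<open>- x\<close> and \<open>y - x\<close> lie in
  \<open>{0..L}\<close>, which is the displayed interval. There the two exponentials merge, and the
  two factors \<open>L powr (-1/2)\<close> give \<open>1 / L\<close>.\<close>

lemma convolution_star_U:
  assumes "L > 0" "\<bar>y\<bar> \<le> L"
  shows "convolution (star (U L m)) (U L n) y =
    (LINT x|lborel. indicator {max (- L) (y - L)..min 0 y} x *\<^sub>R
      (exp (2 * of_real pi * \<i> * of_int n * of_real y / of_real L) / of_real L *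
       exp (2 * of_real pi * \<i> * of_int (m - n) / of_real L * of_real x)))"
  unfolding convolution_def
proof (rule Bochner_Integration.integral_cong[OF refl])
  fix x
  have LL: "complex_of_real (L powr (-1/2)) * complex_of_real (L powr (-1/2)) = 1 / of_real L"
    using assms(1) by (simp flip: of_real_mult powr_add add: powr_minus_divide)
  have E: "cnj (exp (2 * of_real pi * \<i> * of_int m * of_real (- x) / of_real L)) *
      exp (2 * of_real pi * \<i> * of_int n * of_real (y - x) / of_real L) =
      exp (2 * of_real pi * \<i> * of_int n * of_real y / of_real L) *
       exp (2 * of_real pi * \<i> * of_int (m - n) / of_real L * of_real x)"
    using assms(1) by (simp add: exp_cnj flip: exp_add) (simp add: field_simps)
  show "star (U L m) x * U L n (y - x) = indicator {max (- L) (y - L)..min 0 y} x *\<^sub>R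
      (exp (2 * of_real pi * \<i> * of_int n * of_real y / of_real L) / of_real L *
       exp (2 * of_real pi * \<i> * of_int (m - n) / of_real L * of_real x))"
  proof (cases "x \<in> {max (- L) (y - L)..min 0 y}")
    case True
    then have "- x \<in> {0..L}" "y - x \<in> {0..L}" by auto
    then have "star (U L m) x * U L n (y - x) =
       (of_real (L powr (-1/2)) * of_real (L powr (-1/2))) *
       (cnj (exp (2 * of_real pi * \<i> * of_int m * of_real (- x) / of_real L)) *
        exp (2 * of_real pi * \<i> * of_int n * of_real (y - x) / of_real L))"
      by (simp only: star_def U_def if_True complex_cnj_mult complex_cnj_complex_of_real mult_ac)
    then show ?thesis
      using True unfolding LL E by simp
  next
    case False
    then have "\<not> (- x \<in> {0..L} \<and> y - x \<in> {0..L})" by auto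
    then have "star (U L m) x * U L n (y - x) = 0" by (auto simp: star_def U_def)
    then show ?thesis using False by simp
  qed
qed

lemma integral_Icc_exp:
  fixes c K :: complex
  assumes "a \<le> b" "c \<noteq> 0"
  shows "(LINT x|lborel. indicator {a..b} x *\<^sub>R (K * exp (c * of_real x))) =
    K / c * exp (c * of_real b) - K / c * exp (c * of_real a)"
proof (rule integral_FTC_atLeastAtMost[OF assms(1)])
  fix x
  have "((\<lambda>z. K / c * exp (c * z)) has_field_derivative K * exp (c * of_real x)) (at (of_real x))"
    using assms(2) by (auto intro!: derivative_eq_intros)
  from has_vector_derivative_real_field[OF this, of "{a..b}"]
  show "((\<lambda>x. K / c * exp (c * of_real x)) has_vector_derivative K * exp (c * of_real x))
      (at x within {a..b})"
    by simp
qed (intro continuous_intros)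

text \<open>For equal indices the integrand is constant on an interval of length
  \<open>L - y\<close>, both at \<open>y\<close> and at \<open>- y\<close>. Adding the two conjugate
  values gives \<open>2 * (1 - y / L) * cos a\<close>.\<close>

lemma convolution_star_U_same:
  assumes "L > 0" and y: "y \<in> {0..L}"
  shows "convolution (star (U L n)) (U L n) y + convolution (star (U L n)) (U L n) (- y) =
    1 / of_real pi * psi_kernel_deriv L 0 (of_int n) y"
proof -
  define a where "a = 2 * pi * of_int n * y / L"
  have e: "exp (2 * of_real pi * \<i> * of_int n * of_real y / of_real L) = cis a"
    "exp (2 * of_real pi * \<i> * of_int n * of_real (- y) / of_real L) = cis (- a)"
    by (simp_all add: cis_conv_exp a_def mult_ac)
  have "convolution (star (U L n)) (U L n) y = of_real (1 - y / L) * cis a"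
    using convolution_star_U[of L y n n] y assms(1)
    by (simp only: e) (simp add: max_def min_def scaleR_conv_of_real field_simps)
  moreover have "convolution (star (U L n)) (U L n) (- y) = of_real (1 - y / L) * cis (- a)"
    using convolution_star_U[of L "- y" n n] y assms(1)
    by (simp only: e) (simp add: max_def min_def scaleR_conv_of_real field_simps)
  moreover have "psi_kernel_deriv L 0 (of_int n) y = of_real (2 * pi * (1 - y / L) * cos a)"
  proof -
    \<comment> \<open>Since \<open>n\<close> is an integer, the multiple of \<open>2 * pi\<close>
      drops out and the even function cosine sees only \<open>a\<close>.\<close>
    have "of_int n * (2 * pi * (1 - y / L)) + real 0 * (pi / 2) = 2 * pi * of_int n - a"
      by (simp add: a_def algebra_simps)
    then have "cos (of_int n * (2 * pi * (1 - y / L)) + real 0 * (pi / 2)) = cos a"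
      by (simp add: cos_diff)
    then show ?thesis unfolding psi_kernel_deriv_def by simp
  qed
  ultimately show ?thesis
    by (simp only:) (simp add: complex_eq_iff)
qed

text \<open>For distinct indices the frequency \<open>c\<close> is nonzero, so the integrals over
  \<open>{y - L..0}\<close> and \<open>{- L..- y}\<close> come from an antiderivative. The function
  \<open>exp (c * x)\<close> has period \<open>L\<close>, so the shift by \<open>L\<close> in the
  lower endpoints disappears, and the four remaining terms pair up into two sines.\<close>

lemma convolution_star_U_diff:
  assumes "L > 0" and y: "y \<in> {0..L}" and "n \<noteq> m"
  shows "convolution (star (U L m)) (U L n) y + convolution (star (U L m)) (U L n) (- y) =
    1 / of_real pi / (of_int m - of_int n) * (psi_kernel L 0 (of_int m) y - psi_kernel L 0 (of_int n) y)"
proof -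
  define a where "a k = 2 * pi * of_int k * y / L" for k
  define c where "c = 2 * of_real pi * \<i> * of_int (m - n) / of_real L"
  have c: "c \<noteq> 0" using assms by (simp add: c_def)
  have e: "exp (2 * of_real pi * \<i> * of_int k * of_real y / of_real L) = cis (a k)"
    "exp (2 * of_real pi * \<i> * of_int k * of_real (- y) / of_real L) = cis (- a k)" for k
    by (simp_all add: cis_conv_exp a_def mult_ac)
  \<comment> \<open>Periodicity: the exponent is \<open>2 * pi * \<i>\<close> times the integer
    \<open>n - m\<close>.\<close>
  have per: "exp (c * of_real (- L)) = 1"
  proof -
    have "c * of_real (- L) = of_real (2 * of_int (n - m) * pi) * \<i>"
      using assms(1) by (simp add: c_def field_simps)
    then show ?thesis by (simp only: exp_integer_2pi Ints_of_int)
  qed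
  have cy: "exp (c * of_real y) = cis (a m) / cis (a n)" "exp (c * of_real (- y)) = cis (a n) / cis (a m)"
    unfolding cis_conv_exp exp_diff[symmetric]
    by (intro arg_cong[where f = exp], simp add: c_def a_def diff_divide_distrib algebra_simps)+
  have "exp (c * of_real (y - L)) = exp (c * of_real y) * exp (c * of_real (- L))"
    by (simp add: algebra_simps flip: exp_add)
  then have cyL: "exp (c * of_real (y - L)) = cis (a m) / cis (a n)"
    using per cy by simp
  have ivl: "max (- L) (y - L) = y - L" "min 0 y = 0" "max (- L) (- y - L) = - L" "min 0 (- y) = - y"
    using y by auto
  have *: "convolution (star (U L m)) (U L n) y = cis (a n) / of_real L / c * (1 - cis (a m) / cis (a n))"
    using convolution_star_U[of L y m n] y assms(1)
      integral_Icc_exp[OF _ c, of "y - L" 0 "cis (a n) / of_real L"]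
    by (simp only: e c_def[symmetric] cyL ivl) (simp add: right_diff_distrib)
  have **: "convolution (star (U L m)) (U L n) (- y) =
      cis (- a n) / of_real L / c * (cis (a n) / cis (a m) - 1)"
    using convolution_star_U[of L "- y" m n] y assms(1)
      integral_Icc_exp[OF _ c, of "- L" "- y" "cis (- a n) / of_real L"]
    by (simp only: e c_def[symmetric] cy per ivl) (simp add: right_diff_distrib)
  have "convolution (star (U L m)) (U L n) y + convolution (star (U L m)) (U L n) (- y) =
      ((cis (a n) - cis (- a n)) - (cis (a m) - cis (- a m))) / (of_real L * c)"
    unfolding * ** cis_inverse[symmetric] using c assms(1) by (simp add: field_simps)
  also have "\<dots> = (2 * \<i> * of_real (sin (a n)) - 2 * \<i> * of_real (sin (a m))) / (of_real L * c)"
    by (intro arg_cong2[where f = "(/)"] refl) (simp add: complex_eq_iff)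
  also have "of_real L * c = 2 * \<i> * (of_real pi * (of_int m - of_int n))"
    using assms(1) by (simp add: c_def)
  finally have sum: "convolution (star (U L m)) (U L n) y + convolution (star (U L m)) (U L n) (- y) =
      of_real (sin (a n) - sin (a m)) / (of_real pi * (of_int m - of_int n))"
    by (simp flip: right_diff_distrib)
  \<comment> \<open>Reflection at an integer multiple of \<open>2 * pi\<close> flips the sign of the
    sine, which turns \<open>sin (a n) - sin (a m)\<close> into the kernel at \<open>m\<close> minus
    the kernel at \<open>n\<close>.\<close>
  have "psi_kernel L 0 (of_int k) y = - of_real (sin (a k))" for k
  proof -
    have "2 * pi * of_int k * (1 - y / L) = 2 * pi * of_int k - a k"
      by (simp add: a_def algebra_simps)
    then show ?thesis by (simp add: psi_kernel_0 sin_diff)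
  qed
  then show ?thesis unfolding sum by simp
qed

section \<open>The matrix entries of the quadratic form\<close>

theorem proposition4p1:
  fixes L :: real and \<D> :: "(real \<Rightarrow> complex) \<Rightarrow> complex" and m n :: int
  assumes "L > 0" and "distribution_Icc L \<D>"
  shows "psi L \<D> differentiable (at (of_int n)) \<and>
    Q_form \<D> (U L m) (U L n) =
      (if n \<noteq> m then (psi L \<D> (of_int m) - psi L \<D> (of_int n)) / (of_int m - of_int n)
       else vector_derivative (psi L \<D>) (at (of_int n)))"
proof -
  \<comment> \<open>This one formula yields both the differentiability claim and the value of
    \<open>vector_derivative\<close> in the diagonal case.\<close>
  note psi' = psi_has_vector_derivative[OF assms]
  have G: "psi_kernel L 0 x \<in> smooth_Icc L" for x
    by (rule smooth_Icc_I(2)[where G = "\<lambda>k. psi_kernel L k x",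
          OF assms(1) psi_kernel_has_vector_derivative_y[OF assms(1)] refl])
  have H: "psi_kernel_deriv L 0 x \<in> smooth_Icc L" for x
    by (rule smooth_Icc_I(2)[where G = "\<lambda>k. psi_kernel_deriv L k x",
          OF assms(1) psi_kernel_deriv_has_vector_derivative_y[OF assms(1)] refl])
  have "Q_form \<D> (U L m) (U L n) =
      (psi L \<D> (of_int m) - psi L \<D> (of_int n)) / (of_int m - of_int n)" if "n \<noteq> m"
  proof -
    note GG = smooth_Icc_diff[OF assms(1) G G]
    have "Q_form \<D> (U L m) (U L n) = \<D> (\<lambda>y. 1 / of_real pi / (of_int m - of_int n) *
        (psi_kernel L 0 (of_int m) y - psi_kernel L 0 (of_int n) y))"
      unfolding Q_form_def
      \<comment> \<open>The convolution formula is available only on \<open>{0..L}\<close>, whereas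
        \<open>\<D>\<close> acts on total functions; hence the passage through representatives that
        agree on the interval.\<close>
      by (rule distribution_Icc_cong[OF assms smooth_Icc_cmult[OF assms(1) GG]
            convolution_star_U_diff[OF assms(1) _ that]])
    also have "\<dots> = 1 / of_real pi / (of_int m - of_int n) *
        (\<D> (psi_kernel L 0 (of_int m)) - \<D> (psi_kernel L 0 (of_int n)))"
      by (simp only: distribution_Icc_cmult[OF assms GG] distribution_Icc_diff[OF assms G G])
    finally show ?thesis
      by (simp add: psi_def psi_kernel_0 diff_divide_distrib right_diff_distrib)
  qed
  moreover have "Q_form \<D> (U L n) (U L n) = vector_derivative (psi L \<D>) (at (of_int n))"
  proof -
    have "Q_form \<D> (U L n) (U L n) = \<D> (\<lambda>y. 1 / of_real pi * psi_kernel_deriv L 0 (of_int n) y)"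
      unfolding Q_form_def
      by (rule distribution_Icc_cong[OF assms smooth_Icc_cmult[OF assms(1) H]
            convolution_star_U_same[OF assms(1)]])
    also have "\<dots> = 1 / of_real pi * \<D> (psi_kernel_deriv L 0 (of_int n))"
      by (rule distribution_Icc_cmult[OF assms H])
    finally show ?thesis
      using psi' vector_derivative_at by metis
  qed
  ultimately show ?thesis
    using psi' differentiableI_vector by auto
qed

end
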